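(* Suppose $f\in L^{6/5}(\mathbb{R}^3)$ is nonnegative and is a stationary collisional weak solution of the Krieger--Strain equation, i.e. for every $\varphi\in C_c^\infty(\mathbb{R}^3)$, $$\frac{1}{8\pi}\int_{\mathbb{R}^3}\int_{\mathbb{R}^3} f(v)f(w)\,(\nabla_v-\nabla_w)\cdot\left(\frac{\nabla\varphi(v)-\nabla\varphi(w)}{|v-w|}\right)dv\,dw=0 .$$ Then $f\equiv 0$ (almost everywhere).
   Context: For $f\in L^{6/5}(\mathbb{R}^3)$ the Krieger--Strain collision operator $Q_{\rm KS}(f)$ is defined as a distribution by letting $\langle Q_{\rm KS}(f),\varphi\rangle$ be the double integral in the claim, which converges absolutely for such $f$ (by Hardy--Littlewood--Sobolev). A nonnegative $f\in L^{6/5}(\mathbb{R}^3)$ is a stationary collisional weak solution if $Q_{\rm KS}(f)=0$ in the sense of distributions. *)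

theory Defs
  imports "HOL-Analysis.Analysis"
begin

definition gradient :: "('a::euclidean_space \<Rightarrow> real) \<Rightarrow> 'a \<Rightarrow> 'a" where
  "gradient \<phi> x = (\<Sum>b\<in>Basis. frechet_derivative \<phi> (at x) b *\<^sub>R b)"

definition divergence :: "('a::euclidean_space \<Rightarrow> 'a) \<Rightarrow> 'a \<Rightarrow> real" where
  "divergence F x = (\<Sum>b\<in>Basis. frechet_derivative F (at x) b \<bullet> b)"

primrec C_k :: "nat \<Rightarrow> ('a::euclidean_space \<Rightarrow> real) \<Rightarrow> bool" where
  "C_k 0 \<phi> \<longleftrightarrow> continuous_on UNIV \<phi>"
| "C_k (Suc k) \<phi> \<longleftrightarrow>
     (\<forall>x. \<phi> differentiable (at x)) \<and>
     (\<forall>b\<in>Basis. C_k k (\<lambda>x. frechet_derivative \<phi> (at x) b))"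

definition test_function :: "('a::euclidean_space \<Rightarrow> real) \<Rightarrow> bool" where
  "test_function \<phi> \<longleftrightarrow> (\<forall>k. C_k k \<phi>) \<and> compact (closure {x. \<phi> x \<noteq> 0})"

definition in_Lp :: "real \<Rightarrow> ('a::euclidean_space \<Rightarrow> real) \<Rightarrow> bool" where
  "in_Lp p f \<longleftrightarrow> f \<in> borel_measurable lebesgue \<and> integrable lebesgue (\<lambda>x. \<bar>f x\<bar> powr p)"

definition KS_flux :: "('a::euclidean_space \<Rightarrow> real) \<Rightarrow> 'a \<Rightarrow> 'a \<Rightarrow> 'a" where
  "KS_flux \<phi> v w = (gradient \<phi> v - gradient \<phi> w) /\<^sub>R norm (v - w)"

(* The operator (grad_v - grad_w) . acting on the flux. The flux is singular on the
   diagonal v = w, where the value below is irrelevant: the diagonal is a null set. *)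
definition KS_kernel :: "('a::euclidean_space \<Rightarrow> real) \<Rightarrow> 'a \<Rightarrow> 'a \<Rightarrow> real" where
  "KS_kernel \<phi> v w =
     divergence (\<lambda>v'. KS_flux \<phi> v' w) v - divergence (\<lambda>w'. KS_flux \<phi> v w') w"

(* The pairing of Q_KS(f) with \<phi>. The double integral is taken with respect to Lebesgue
   measure on the product space; for f in L^(6/5) it converges absolutely by
   Hardy-Littlewood-Sobolev, so the value 0 that the Bochner integral assigns to
   non-integrable functions plays no role. *)
definition KS_pairing :: "(real^3 \<Rightarrow> real) \<Rightarrow> (real^3 \<Rightarrow> real) \<Rightarrow> real" where
  "KS_pairing f \<phi> =
     1 / (8 * pi) *
     (\<integral>z. f (fst z) * f (snd z) * KS_kernel \<phi> (fst z) (snd z)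
        \<partial>(lebesgue :: ((real^3) \<times> (real^3)) measure))"

end

theory Submission
  imports Defs "HOL-Real_Asymp.Real_Asymp"
begin

text \<open>
  The operator increases kinetic energy at a definite rate. Inserting
  \<open>\<phi> v = norm v ^ 2\<close> into the kernel gives, in dimension \<open>d\<close>,
  \<open>4 * d / norm (v - w) - 4 / norm (v - w)\<close>, which is \<open>8 / norm (v - w)\<close> in dimension three. So if this
  \<open>\<phi>\<close> could be used as a test function, a stationary solution would satisfy
  that \<open>f v * f w / norm (v - w)\<close> has integral zero. As the integrand is nonnegative, the product
  \<open>f v * f w\<close> would vanish almost everywhere, and hence so would \<open>f\<close>.

  The energy is replaced by the compactly supported functions \<open>bump a v / a\<close>, where
  \<open>bump a v = exp (- 1 / (1 - a * norm v ^ 2))\<close> inside the ball where \<open>a * norm v ^ 2 < 1\<close>. As \<open>a\<close>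
  tends to zero, their second derivatives converge to those of \<open>- exp (- 1) * norm v ^ 2\<close>, and so do the
  kernels (\<open>bump_kernel_tendsto\<close>). Since these second derivatives are bounded uniformly in \<open>a\<close>, the
  kernels are bounded by a fixed multiple of \<open>1 / norm (v - w)\<close> (\<open>abs_KS_kernel_bump_le\<close>).
  Passing to the limit by dominated convergence then only needs that
  \<open>f v * f w / norm (v - w)\<close> is integrable, which is the Hardy--Littlewood--Sobolev inequality for
  the exponent \<open>6/5\<close> (\<open>Coulomb_energy_integrable\<close>). It has a short direct proof: by symmetry one may
  restrict to \<open>f w \<le> f v\<close>, and the potential at \<open>v\<close> of the part of \<open>f\<close> that lies below the level
  \<open>t = f v\<close> is of order \<open>t powr (1/5)\<close>, since near \<open>v\<close> it is bounded by means of \<open>t\<close> and far from \<open>v\<close>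
  by Hoelder's inequality (\<open>truncated_potential_le\<close>).
\<close>

section \<open>Finite Coulomb energy of functions in L to the 6/5\<close>

text \<open>A form of Young's inequality with a free scale \<open>l\<close>: either \<open>x\<close> is below the
  threshold \<open>l powr (-5)\<close>, or the surplus power \<open>x powr (1/5)\<close> is at least \<open>1 / l\<close>.\<close>

lemma le_scaled_powr_add:
  fixes x l :: real
  assumes "0 \<le> x" "0 < l"
  shows "x \<le> l * x powr (6/5) + l powr (-5)"
proof (cases "x \<le> l powr (-5)")
  case True
  then show ?thesis using assms by (simp add: add_increasing)
next
  case False
  then have x: "l powr (-5) < x" "0 < x"
    using assms order.strict_trans1[OF powr_ge_zero, of l "-5" x] by auto
  have "1 = l powr 1 * l powr (-1)"
    using assms unfolding powr_add[symmetric] by simp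
  also have "\<dots> = l * (l powr (-5)) powr (1/5)"
    using assms unfolding powr_powr by simp
  also have "\<dots> \<le> l * x powr (1/5)"
    using x assms by (intro mult_left_mono powr_mono2) auto
  finally have "1 \<le> l * x powr (1/5)" .
  then have "x * 1 \<le> x * (l * x powr (1/5))"
    using x by (intro mult_left_mono) auto
  also have "\<dots> = l * x powr (6/5)"
    using powr_add[of x 1 "1/5"] x by simp
  finally show ?thesis by (simp add: add_increasing2)
qed

text \<open>Hoelder's inequality bounds the mass of a ball by a multiple of its volume to the power
  \<open>1/6\<close>. Young's inequality with the scale \<open>sqrt s\<close>, for which both resulting terms
  are of order \<open>sqrt s\<close>, gives the same growth in \<open>s\<close>.\<close>

lemma nn_integral_cball_le_sqrt:
  fixes g :: "'a::euclidean_space \<Rightarrow> real"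
  assumes dim: "DIM('a) = 3"
    and [measurable]: "g \<in> borel_measurable borel"
    and nonneg: "\<And>x. 0 \<le> g x"
    and int: "integrable lborel (\<lambda>x. g x powr (6/5))"
    and s: "0 < s"
  shows "(\<integral>\<^sup>+w. ennreal (g w) * indicator (cball v s) w \<partial>lborel)
    \<le> ennreal (((\<integral>w. g w powr (6/5) \<partial>lborel) + unit_ball_vol 3) * sqrt s)"
proof -
  have split: "(\<integral>\<^sup>+w. a * F w + b * indicator B w \<partial>lborel) = a * (\<integral>\<^sup>+w. F w \<partial>lborel) + b * emeasure lborel B"
    if [measurable]: "F \<in> borel_measurable borel" "B \<in> sets borel" for a b :: ennreal and F and B :: "'a set"
    by (simp add: nn_integral_add nn_integral_cmult nn_integral_cmult_indicator)
  have "(\<integral>\<^sup>+w. ennreal (g w) * indicator (cball v s) w \<partial>lborel)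
    \<le> (\<integral>\<^sup>+w. ennreal (sqrt s) * ennreal (g w powr (6/5))
          + ennreal (sqrt s powr (-5)) * indicator (cball v s) w \<partial>lborel)"
    using le_scaled_powr_add[OF nonneg, of "sqrt s"] s
    by (intro nn_integral_mono)
      (auto simp: indicator_def ennreal_mult[symmetric] ennreal_plus[symmetric] ennreal_leI
        simp del: ennreal_plus)
  also have "\<dots> = ennreal (sqrt s) * (\<integral>\<^sup>+w. ennreal (g w powr (6/5)) \<partial>lborel)
      + ennreal (sqrt s powr (-5)) * emeasure lborel (cball v s)"
    by (rule split) auto
  also have "(\<integral>\<^sup>+w. ennreal (g w powr (6/5)) \<partial>lborel) = ennreal (\<integral>w. g w powr (6/5) \<partial>lborel)"
    by (intro nn_integral_eq_integral int) auto
  also have "emeasure lborel (cball v s) = ennreal (unit_ball_vol 3 * s ^ 3)"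
    using s by (simp add: emeasure_cball dim)
  also have "ennreal (sqrt s) * ennreal (\<integral>w. g w powr (6/5) \<partial>lborel)
      + ennreal (sqrt s powr (-5)) * ennreal (unit_ball_vol 3 * s ^ 3)
    = ennreal (sqrt s * (\<integral>w. g w powr (6/5) \<partial>lborel) + sqrt s powr (-5) * (unit_ball_vol 3 * s ^ 3))"
    using s by (simp add: ennreal_mult)
  also have "sqrt s powr (-5) * (unit_ball_vol 3 * s ^ 3) = unit_ball_vol 3 * sqrt s"
  proof -
    have "sqrt s powr (-5) * s ^ 3 = s powr (-5/2) * s powr 3"
      using s by (simp add: powr_half_sqrt[symmetric] powr_powr)
    also have "\<dots> = s powr (1/2)"
      unfolding powr_add[symmetric] by simp
    also have "\<dots> = sqrt s"
      using s by (simp add: powr_half_sqrt)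
    finally show ?thesis by (simp add: mult_ac)
  qed
  finally show ?thesis by (simp add: algebra_simps)
qed

lemma inverse_eq_nn_integral_inverse_square:
  fixes r :: real
  assumes "0 < r"
  shows "ennreal (1 / r) = (\<integral>\<^sup>+s. ennreal (1 / s\<^sup>2) * indicator {r..} s \<partial>lborel)"
proof -
  have "((\<lambda>s::real. - (1 / s)) \<longlongrightarrow> 0) at_top"
    by real_asymp
  then have "(\<integral>\<^sup>+s. ennreal (1 / s\<^sup>2) * indicator {r..} s \<partial>lborel) = ennreal (0 - (- (1 / r)))"
    using assms
    by (intro nn_integral_FTC_atLeast)
      (auto intro!: derivative_eq_intros simp: power2_eq_square)
  then show ?thesis by simp
qed

text \<open>The core of the Hardy--Littlewood--Sobolev bound. The layer-cake formula
  \<open>1 / r = (integral of 1 / s\<^sup>2 over s \<ge> r)\<close> reduces the potential at \<open>v\<close> to the masses of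
  the balls around \<open>v\<close>. Where the density is at most \<open>t\<close>, the ball of radius \<open>s\<close> has mass at
  most \<open>t\<close> times its volume, which is the better bound for small \<open>s\<close>; for large \<open>s\<close> the
  growth like \<open>sqrt s\<close> is better.\<close>

lemma truncated_potential_le:
  fixes g :: "'a::euclidean_space \<Rightarrow> real"
  assumes dim: "DIM('a) = 3"
    and [measurable]: "g \<in> borel_measurable borel"
    and nonneg: "\<And>x. 0 \<le> g x"
    and int: "integrable lborel (\<lambda>x. g x powr (6/5))"
    and t: "0 < t"
  defines "S \<equiv> \<integral>w. g w powr (6/5) \<partial>lborel"
  shows "(\<integral>\<^sup>+w. ennreal (g w / norm (v - w)) * indicator {w. g w \<le> t} w \<partial>lborel)
    \<le> ennreal ((2 * S + 5/2 * unit_ball_vol 3) * t powr (1/5))"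
proof -
  define c :: real where "c = unit_ball_vol 3"
  \<comment> \<open>The radius at which \<open>t * R\<^sup>2\<close> and \<open>R powr (-1/2)\<close>, the orders of the two parts of the
    integral over \<open>s\<close>, agree.\<close>
  define R where "R = t powr (-2/5)"
  have S: "0 \<le> S" unfolding S_def by simp
  have c: "0 \<le> c" unfolding c_def by simp
  have R: "0 < R" using t by (simp add: R_def)
  define m where "m s = (\<integral>\<^sup>+w. ennreal (g w) * indicator {w. g w \<le> t} w * indicator (cball v s) w \<partial>lborel)" for s
  have m1: "m s \<le> ennreal ((S + c) * sqrt s)" if "0 < s" for s
    unfolding S_def c_def
    by (rule order.trans[OF _ nn_integral_cball_le_sqrt[OF dim _ nonneg int that, of v]])
      (auto simp: m_def indicator_def intro!: nn_integral_mono)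
  have m2: "m s \<le> ennreal (t * c * s ^ 3)" if "0 < s" for s
  proof -
    have "m s \<le> (\<integral>\<^sup>+w. ennreal t * indicator (cball v s) w \<partial>lborel)"
      unfolding m_def by (intro nn_integral_mono) (auto simp: indicator_def ennreal_leI)
    also have "\<dots> = ennreal (t * c * s ^ 3)"
      using that t c by (simp add: nn_integral_cmult_indicator emeasure_cball dim c_def ennreal_mult mult_ac)
    finally show ?thesis .
  qed
  have "(\<integral>\<^sup>+w. ennreal (g w / norm (v - w)) * indicator {w. g w \<le> t} w \<partial>lborel)
    \<le> (\<integral>\<^sup>+w. (\<integral>\<^sup>+s. ennreal (g w) * indicator {w. g w \<le> t} w * (ennreal (1 / s\<^sup>2) * indicator {norm (v - w)..} s) \<partial>lborel) \<partial>lborel)"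
  proof (intro nn_integral_mono)
    fix w
    show "ennreal (g w / norm (v - w)) * indicator {w. g w \<le> t} w
      \<le> (\<integral>\<^sup>+s. ennreal (g w) * indicator {w. g w \<le> t} w * (ennreal (1 / s\<^sup>2) * indicator {norm (v - w)..} s) \<partial>lborel)"
    proof (cases "v = w")
      case False
      then have "ennreal (g w / norm (v - w)) = ennreal (g w) * ennreal (1 / norm (v - w))"
        using nonneg[of w] by (simp add: ennreal_mult[symmetric])
      with False show ?thesis
        by (cases "g w \<le> t")
          (simp_all add: nn_integral_cmult inverse_eq_nn_integral_inverse_square)
    qed simp
  qed
  also have "\<dots> = (\<integral>\<^sup>+s. (\<integral>\<^sup>+w. ennreal (g w) * indicator {w. g w \<le> t} w * (ennreal (1 / s\<^sup>2) * indicator {norm (v - w)..} s) \<partial>lborel) \<partial>lborel)"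
  proof (intro lborel_pair.Fubini')
    have "(\<lambda>(s, w). if g w \<le> t \<and> norm (v - w) \<le> s then ennreal (g w) * ennreal (1 / s\<^sup>2) else 0)
        \<in> borel_measurable (lborel \<Otimes>\<^sub>M lborel)"
      by measurable
    also have "(\<lambda>(s, w). if g w \<le> t \<and> norm (v - w) \<le> s then ennreal (g w) * ennreal (1 / s\<^sup>2) else 0)
        = (\<lambda>(s, w). ennreal (g w) * indicator {w. g w \<le> t} w * (ennreal (1 / s\<^sup>2) * indicator {norm (v - w)..} s))"
      by (auto simp: fun_eq_iff)
    finally show "(\<lambda>(s, w). ennreal (g w) * indicator {w. g w \<le> t} w * (ennreal (1 / s\<^sup>2) * indicator {norm (v - w)..} s))
        \<in> borel_measurable (lborel \<Otimes>\<^sub>M lborel)" .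
  qed
  also have "\<dots> \<le> (\<integral>\<^sup>+s. ennreal (1 / s\<^sup>2) * m s * indicator {0<..} s \<partial>lborel)"
    \<comment> \<open>At \<open>s = 0\<close> the ball is a single point, so only a null set of radii is lost.\<close>
  proof (rule nn_integral_mono_AE, rule AE_mp[OF AE_lborel_singleton[of 0]], intro AE_I2 impI)
    fix s :: real assume "s \<noteq> 0"
    have "(\<integral>\<^sup>+w. ennreal (g w) * indicator {w. g w \<le> t} w * (ennreal (1 / s\<^sup>2) * indicator {norm (v - w)..} s) \<partial>lborel)
      = (\<integral>\<^sup>+w. ennreal (1 / s\<^sup>2) * (ennreal (g w) * indicator {w. g w \<le> t} w * indicator (cball v s) w) \<partial>lborel)"
      by (intro nn_integral_cong) (auto simp: indicator_def dist_norm mult.commute)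
    also have "\<dots> = ennreal (1 / s\<^sup>2) * m s"
      unfolding m_def
      by (intro nn_integral_cmult borel_measurable_times_ennreal borel_measurable_indicator) auto
    also have "m s = m s * indicator {0<..} s"
      using \<open>s \<noteq> 0\<close> by (cases "0 < s") (simp_all add: m_def)
    finally show "(\<integral>\<^sup>+w. ennreal (g w) * indicator {w. g w \<le> t} w * (ennreal (1 / s\<^sup>2) * indicator {norm (v - w)..} s) \<partial>lborel)
      \<le> ennreal (1 / s\<^sup>2) * m s * indicator {0<..} s"
      by (simp add: mult_ac)
  qed
  also have "\<dots> \<le> (\<integral>\<^sup>+s. ennreal (t * c * s) * indicator {0..R} s
      + ennreal ((S + c) * s powr (-3/2)) * indicator {R..} s \<partial>lborel)"
  proof (intro nn_integral_mono)
    fix s :: real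
    consider "s \<le> 0" | "0 < s" "s \<le> R" | "R < s" by linarith
    then show "ennreal (1 / s\<^sup>2) * m s * indicator {0<..} s \<le> ennreal (t * c * s) * indicator {0..R} s
      + ennreal ((S + c) * s powr (-3/2)) * indicator {R..} s"
    proof cases
      case 2
      have "ennreal (1 / s\<^sup>2) * m s \<le> ennreal (1 / s\<^sup>2) * ennreal (t * c * s ^ 3)"
        by (intro mult_left_mono m2 2) auto
      also have "\<dots> = ennreal (t * c * s)"
        using 2 t c by (subst ennreal_mult[symmetric]) (auto simp: power2_eq_square power3_eq_cube)
      finally show ?thesis using 2 by (auto simp: indicator_def add_increasing2)
    next
      case 3
      then have s: "0 < s" using R by simp
      have "ennreal (1 / s\<^sup>2) * m s \<le> ennreal (1 / s\<^sup>2) * ennreal ((S + c) * sqrt s)"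
        by (intro mult_left_mono m1 s) auto
      also have "\<dots> = ennreal ((S + c) * (sqrt s / s\<^sup>2))"
        using S c s by (subst ennreal_mult[symmetric]) auto
      also have "sqrt s / s\<^sup>2 = s powr (-3/2)"
        using s powr_diff[of s "1/2" 2] by (simp add: powr_half_sqrt)
      finally show ?thesis using 3 by (auto simp: indicator_def)
    qed simp
  qed
  also have "\<dots> = (\<integral>\<^sup>+s. ennreal (t * c * s) * indicator {0..R} s \<partial>lborel)
     + (\<integral>\<^sup>+s. ennreal ((S + c) * s powr (-3/2)) * indicator {R..} s \<partial>lborel)"
    by (intro nn_integral_add) measurable
  also have "(\<integral>\<^sup>+s. ennreal (t * c * s) * indicator {0..R} s \<partial>lborel)
      = ennreal (t * c * R\<^sup>2 / 2 - t * c * 0\<^sup>2 / 2)"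
    using R t c by (intro nn_integral_FTC_Icc) (auto intro!: derivative_eq_intros)
  also have "(\<integral>\<^sup>+s. ennreal ((S + c) * s powr (-3/2)) * indicator {R..} s \<partial>lborel)
      = ennreal (0 - (- (2 * (S + c) * R powr (-1/2))))"
  proof (intro nn_integral_FTC_atLeast)
    show "((\<lambda>s. - (2 * (S + c) * s powr (-1/2))) \<longlongrightarrow> 0) at_top"
      by real_asymp
    fix s assume "R \<le> s"
    then have "0 < s" using R by simp
    then show "((\<lambda>s. - (2 * (S + c) * s powr (-1/2))) has_real_derivative (S + c) * s powr (-3/2)) (at s)"
      by (auto intro!: derivative_eq_intros)
  qed (use S c in auto)
  also have "ennreal (t * c * R\<^sup>2 / 2 - t * c * 0\<^sup>2 / 2) + ennreal (0 - (- (2 * (S + c) * R powr (-1/2))))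
    = ennreal (c * (t * R\<^sup>2) / 2 + 2 * (S + c) * R powr (-1/2))"
    using t c S by (simp add: ennreal_plus[symmetric] mult_ac del: ennreal_plus)
  also have "t * R\<^sup>2 = t powr (1/5)"
  proof -
    have "t * R\<^sup>2 = t powr 1 * (t powr (-2/5) * t powr (-2/5))"
      using t by (simp add: R_def power2_eq_square)
    also have "\<dots> = t powr (1/5)" unfolding powr_add[symmetric] by simp
    finally show ?thesis .
  qed
  also have "R powr (-1/2) = t powr (1/5)"
    unfolding R_def by (simp add: powr_powr)
  also have "c * t powr (1/5) / 2 + 2 * (S + c) * t powr (1/5)
    = (2 * S + 5/2 * unit_ball_vol 3) * t powr (1/5)"
    by (simp add: c_def algebra_simps)
  finally show ?thesis .
qed

text \<open>The diagonal case of the Hardy--Littlewood--Sobolev inequality, in qualitative form. By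
  symmetry it suffices to integrate over the pairs with \<open>g w \<le> g v\<close>. There the potential of the
  density truncated at level \<open>t = g v\<close> is of order \<open>t powr (1/5)\<close>, which is exactly the factor that
  turns the remaining \<open>g v\<close> into the integrable \<open>g v powr (6/5)\<close>.\<close>

lemma Coulomb_energy_integrable:
  fixes g :: "'a::euclidean_space \<Rightarrow> real"
  assumes dim: "DIM('a) = 3"
    and [measurable]: "g \<in> borel_measurable borel"
    and nonneg: "\<And>x. 0 \<le> g x"
    and int: "integrable lborel (\<lambda>x. g x powr (6/5))"
  shows "integrable lborel (\<lambda>z::'a \<times> 'a. g (fst z) * g (snd z) / norm (fst z - snd z))"
proof (rule integrableI_nonneg)
  define S where "S = (\<integral>w. g w powr (6/5) \<partial>lborel)"
  define K where "K = 2 * S + 5/2 * unit_ball_vol 3"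
  have K: "0 \<le> K" unfolding K_def S_def by simp
  define A :: "'a \<Rightarrow> 'a \<Rightarrow> ennreal"
    where "A v w = (if g w \<le> g v then ennreal (g v) * ennreal (g w / norm (v - w)) else 0)" for v w
  have A_meas: "(\<lambda>z. A (fst z) (snd z)) \<in> borel_measurable (lborel \<Otimes>\<^sub>M lborel)"
     "(\<lambda>z. A (snd z) (fst z)) \<in> borel_measurable (lborel \<Otimes>\<^sub>M lborel)"
    unfolding A_def by measurable
  have A_int: "(\<integral>\<^sup>+w. A v w \<partial>lborel) \<le> ennreal (K * g v powr (6/5))" for v
  proof (cases "g v = 0")
    case False
    then have gv: "0 < g v" using nonneg[of v] by simp
    have "(\<integral>\<^sup>+w. A v w \<partial>lborel) = ennreal (g v) * (\<integral>\<^sup>+w. ennreal (g w / norm (v - w)) * indicator {w. g w \<le> g v} w \<partial>lborel)"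
      by (subst nn_integral_cmult[symmetric], measurable)
        (auto simp: A_def indicator_def intro!: nn_integral_cong)
    also have "\<dots> \<le> ennreal (g v) * ennreal (K * g v powr (1/5))"
      unfolding K_def S_def
      by (intro mult_left_mono truncated_potential_le[OF dim _ nonneg int gv]) auto
    also have "\<dots> = ennreal (K * (g v powr 1 * g v powr (1/5)))"
      using gv K by (simp add: ennreal_mult''[symmetric] mult_ac)
    finally show ?thesis unfolding powr_add[symmetric] by simp
  qed (simp add: A_def if_distrib cong: if_cong)
  have total: "(\<integral>\<^sup>+v. (\<integral>\<^sup>+w. A v w \<partial>lborel) \<partial>lborel) \<le> ennreal (K * S)"
  proof -
    have "(\<integral>\<^sup>+v. (\<integral>\<^sup>+w. A v w \<partial>lborel) \<partial>lborel) \<le> (\<integral>\<^sup>+v. ennreal (K * g v powr (6/5)) \<partial>lborel)"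
      by (intro nn_integral_mono A_int)
    also have "\<dots> = ennreal (\<integral>v. K * g v powr (6/5) \<partial>lborel)"
      using int K by (intro nn_integral_eq_integral) auto
    finally show ?thesis by (simp add: S_def)
  qed
  have "(\<integral>\<^sup>+z. ennreal (g (fst z) * g (snd z) / norm (fst z - snd z)) \<partial>lborel)
     \<le> (\<integral>\<^sup>+z. A (fst z) (snd z) + A (snd z) (fst z) \<partial>(lborel \<Otimes>\<^sub>M lborel))"
    unfolding lborel_prod A_def using nonneg
    by (intro nn_integral_mono)
      (auto simp: indicator_def ennreal_mult[symmetric] norm_minus_commute mult_ac)
  also have "\<dots> = (\<integral>\<^sup>+z. A (fst z) (snd z) \<partial>(lborel \<Otimes>\<^sub>M lborel)) + (\<integral>\<^sup>+z. A (snd z) (fst z) \<partial>(lborel \<Otimes>\<^sub>M lborel))"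
    by (intro nn_integral_add A_meas)
  also have "(\<integral>\<^sup>+z. A (fst z) (snd z) \<partial>(lborel \<Otimes>\<^sub>M lborel)) = (\<integral>\<^sup>+v. (\<integral>\<^sup>+w. A v w \<partial>lborel) \<partial>lborel)"
    using lborel.nn_integral_fst[OF A_meas(1)] by simp
  also have "(\<integral>\<^sup>+z. A (snd z) (fst z) \<partial>(lborel \<Otimes>\<^sub>M lborel)) = (\<integral>\<^sup>+v. (\<integral>\<^sup>+w. A v w \<partial>lborel) \<partial>lborel)"
    using lborel_pair.nn_integral_snd[OF A_meas(2)] by simp
  also have "\<dots> + \<dots> \<le> ennreal (K * S) + ennreal (K * S)"
    by (intro add_mono total)
  also have "\<dots> < \<infinity>" by (simp add: less_top[symmetric])
  finally show "(\<integral>\<^sup>+z. ennreal (g (fst z) * g (snd z) / norm (fst z - snd z)) \<partial>(lborel :: ('a \<times> 'a) measure)) < \<infinity>" .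
  show "(\<lambda>z::'a \<times> 'a. g (fst z) * g (snd z) / norm (fst z - snd z)) \<in> borel_measurable lborel"
    unfolding lborel_prod[symmetric] by measurable
qed (use nonneg in auto)

section \<open>Smooth functions and a flat exponential\<close>

text \<open>Smoothness by coinduction: a set of functions that is closed under partial derivatives
  consists of smooth functions.\<close>

lemma C_k_of_derivative_closed:
  fixes S :: "('a::euclidean_space \<Rightarrow> real) set"
  assumes closed: "\<And>g. g \<in> S \<Longrightarrow>
      \<exists>g'. (\<forall>x. (g has_derivative g' x) (at x)) \<and> (\<forall>b\<in>Basis. (\<lambda>x. g' x b) \<in> S)"
    and "g \<in> S"
  shows "C_k k g"
  using \<open>g \<in> S\<close>
proof (induction k arbitrary: g)
  case 0
  then obtain g' where "\<And>x. (g has_derivative g' x) (at x)"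
    using closed by blast
  then show ?case
    by (auto intro!: continuous_at_imp_continuous_on has_derivative_continuous)
next
  case (Suc k)
  then obtain g' where g': "\<And>x. (g has_derivative g' x) (at x)" "\<And>b. b \<in> Basis \<Longrightarrow> (\<lambda>x. g' x b) \<in> S"
    using closed by blast
  then have "(\<lambda>x. frechet_derivative g (at x) b) = (\<lambda>x. g' x b)" for b
    using frechet_derivative_at by (metis (no_types, lifting))
  with g' Suc.IH show ?case
    by (auto simp: differentiable_def)
qed

text \<open>The functions \<open>exp (- 1 / x) / x ^ n\<close>, extended by zero to \<open>x \<le> 0\<close>. The case \<open>n = 0\<close> is the
  standard smooth function that is flat at the origin; the other \<open>n\<close> are included because the
  derivatives of this function are linear combinations of them.\<close>

definition flat_exp :: "nat \<Rightarrow> real \<Rightarrow> real" where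
  "flat_exp n x = (if x \<le> 0 then 0 else exp (- (1 / x)) / x ^ n)"

lemma power_div_fact_le_exp:
  fixes x :: real
  assumes "0 \<le> x"
  shows "x ^ n / fact n \<le> exp x"
  using sum_le_suminf[OF sums_summable[OF exp_converges[of x]], of "{n}"] assms
    sums_unique[OF exp_converges[of x]]
  by (simp add: divide_inverse mult.commute)

text \<open>The \<open>(n + 2)\<close>-nd term of the exponential series at \<open>1 / x\<close> beats the factor \<open>1 / x ^ n\<close> and leaves
  \<open>x\<^sup>2\<close>. This single estimate gives both the vanishing derivative at the origin and the bounds on
  the half-line \<open>x \<le> 1\<close>.\<close>

lemma abs_flat_exp_le: "\<bar>flat_exp n x\<bar> \<le> fact (n + 2) * x\<^sup>2"
proof (cases "x \<le> 0")
  case False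
  then have x: "0 < x" by simp
  define K :: real where "K = fact (n + 2)"
  have K: "0 < K" by (simp add: K_def del: fact_Suc)
  have "(1 / x) ^ (n + 2) / K \<le> exp (1 / x)"
    unfolding K_def using x by (intro power_div_fact_le_exp) simp
  then have "1 \<le> exp (1 / x) * (K * x ^ (n + 2))"
    using x K by (simp add: power_one_over divide_le_eq pos_divide_le_eq mult_ac)
  then have "exp (- (1 / x)) * 1 \<le> exp (- (1 / x)) * (exp (1 / x) * (K * x ^ (n + 2)))"
    by (intro mult_left_mono) auto
  also have "\<dots> = K * x ^ (n + 2)"
    unfolding mult.assoc[symmetric] exp_add[symmetric] by simp
  finally have "exp (- (1 / x)) \<le> K * x\<^sup>2 * x ^ n"
    by (simp add: power_add power2_eq_square mult_ac)
  then have "\<bar>flat_exp n x\<bar> \<le> K * x\<^sup>2"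
    using x by (simp add: flat_exp_def pos_divide_le_eq)
  then show ?thesis by (simp only: K_def)
qed (simp add: flat_exp_def)

lemma flat_exp_has_derivative:
  "(flat_exp n has_real_derivative (flat_exp (n + 2) x - n * flat_exp (n + 1) x)) (at x)"
proof -
  consider "x < 0" | "x = 0" | "0 < x" by linarith
  then show ?thesis
  proof cases
    case 1
    have "((\<lambda>_. 0) has_real_derivative 0) (at x)" by simp
    then have "(flat_exp n has_real_derivative 0) (at x)"
      by (rule has_field_derivative_transform_within_open[of _ _ _ "{..<0}"])
        (use 1 in \<open>auto simp: flat_exp_def\<close>)
    with 1 show ?thesis by (simp add: flat_exp_def)
  next
    case 2
    have "((\<lambda>h. (flat_exp n (0 + h) - flat_exp n 0) / h) \<longlongrightarrow> 0) (at 0)"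
    proof (rule Lim_null_comparison)
      show "\<forall>\<^sub>F h in at 0. norm ((flat_exp n (0 + h) - flat_exp n 0) / h) \<le> fact (n + 2) * \<bar>h\<bar>"
      proof (rule eventuallyI)
        fix h :: real
        show "norm ((flat_exp n (0 + h) - flat_exp n 0) / h) \<le> fact (n + 2) * \<bar>h\<bar>"
          using abs_flat_exp_le[of n h]
          by (cases "h = 0")
            (auto simp: flat_exp_def[of _ 0] abs_divide divide_le_eq abs_mult_self_eq power2_eq_square
              mult.assoc simp del: fact_Suc)
      qed
      show "((\<lambda>h::real. fact (n + 2) * \<bar>h\<bar>) \<longlongrightarrow> 0) (at 0)"
        by (auto intro!: tendsto_eq_intros)
    qed
    with 2 show ?thesis by (simp add: DERIV_def flat_exp_def[of _ 0])
  next
    case 3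
    have "((\<lambda>x. exp (- (1 / x)) / x ^ n) has_real_derivative (flat_exp (n + 2) x - n * flat_exp (n + 1) x)) (at x)"
    proof -
      have power: "((\<lambda>x. inverse x ^ n) has_real_derivative - (n * inverse x ^ (n + 1))) (at x)"
        using DERIV_power[OF DERIV_inverse[of x], of n] 3 by (cases n) (simp_all add: algebra_simps)
      have "((\<lambda>x. exp (- (1 / x))) has_real_derivative exp (- (1 / x)) * inverse x ^ 2) (at x)"
        using 3 by (auto intro!: derivative_eq_intros simp: divide_inverse power2_eq_square)
      from DERIV_mult[OF this power] have "((\<lambda>x. exp (- (1 / x)) * inverse x ^ n) has_real_derivative
          exp (- (1 / x)) * inverse x ^ 2 * inverse x ^ n
          + - (n * inverse x ^ (n + 1)) * exp (- (1 / x))) (at x)"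
        .
      with 3 show ?thesis
        by (simp add: flat_exp_def divide_inverse power_inverse power_add power2_eq_square algebra_simps)
    qed
    then show ?thesis
      by (rule has_field_derivative_transform_within_open[of _ _ _ "{0<..}"])
        (use 3 in \<open>auto simp: flat_exp_def\<close>)
  qed
qed

lemma isCont_flat_exp: "isCont (flat_exp n) x"
  using flat_exp_has_derivative by (rule DERIV_isCont)

lemma borel_measurable_flat_exp [measurable]: "flat_exp n \<in> borel_measurable borel"
  using isCont_flat_exp continuous_at_imp_continuous_on by (blast intro: borel_measurable_continuous_onI)

lemma has_derivative_flat_exp [derivative_intros]:
  assumes "(g has_derivative g') (at x)"
  shows "((\<lambda>x. flat_exp n (g x)) has_derivative
     (\<lambda>h. g' h * (flat_exp (n + 2) (g x) - n * flat_exp (n + 1) (g x)))) (at x)"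
  using has_derivative_compose[OF assms flat_exp_has_derivative[unfolded has_field_derivative_def]]
  by (simp add: mult.commute)

text \<open>With \<open>y = a * (v \<bullet> v)\<close> these bounds control the derivatives of the test functions below
  uniformly in \<open>a\<close>; the second one absorbs the quadratic factor \<open>v \<bullet> v\<close> of the second derivatives.\<close>

lemma abs_flat_exp_one_minus_le:
  assumes "0 \<le> y"
  shows "\<bar>flat_exp n (1 - y)\<bar> \<le> fact (n + 2)" "y * \<bar>flat_exp n (1 - y)\<bar> \<le> fact (n + 2)"
proof -
  have "\<bar>flat_exp n (1 - y)\<bar> \<le> fact (n + 2) \<and> y * \<bar>flat_exp n (1 - y)\<bar> \<le> fact (n + 2)"
  proof (cases "y \<le> 1")
    case True
    have "\<bar>flat_exp n (1 - y)\<bar> \<le> fact (n + 2) * (1 - y)\<^sup>2" by (rule abs_flat_exp_le)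
    also have "\<dots> \<le> fact (n + 2) * 1"
      using True assms by (intro mult_left_mono power_le_one) auto
    finally have "\<bar>flat_exp n (1 - y)\<bar> \<le> fact (n + 2)" by simp
    moreover have "y * \<bar>flat_exp n (1 - y)\<bar> \<le> 1 * \<bar>flat_exp n (1 - y)\<bar>"
      using True by (intro mult_right_mono) auto
    ultimately show ?thesis by simp
  qed (simp add: flat_exp_def)
  then show "\<bar>flat_exp n (1 - y)\<bar> \<le> fact (n + 2)" "y * \<bar>flat_exp n (1 - y)\<bar> \<le> fact (n + 2)"
    by auto
qed

section \<open>Radial test functions\<close>

text \<open>For \<open>a > 0\<close> it is supported in the ball of radius \<open>1 / sqrt a\<close>. Up to an additive constant that
  depends on \<open>a\<close>, the function \<open>bump a v / a\<close> tends to \<open>- exp (- 1) * (v \<bullet> v)\<close> as \<open>a\<close> tends to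
  zero, so that the test functions serve as compactly supported substitutes for the kinetic energy.\<close>

definition bump :: "real \<Rightarrow> 'a::euclidean_space \<Rightarrow> real" where
  "bump a v = flat_exp 0 (1 - a * (v \<bullet> v))"

text \<open>An algebra of functions that contains \<open>bump a\<close> and is closed under partial derivatives.\<close>

inductive_set bump_algebra :: "real \<Rightarrow> ('a::euclidean_space \<Rightarrow> real) set" for a :: real where
  const: "(\<lambda>_. c) \<in> bump_algebra a"
| coord: "(\<lambda>v. v \<bullet> b) \<in> bump_algebra a"
| flat_exp: "(\<lambda>v. flat_exp n (1 - a * (v \<bullet> v))) \<in> bump_algebra a"
| add: "f \<in> bump_algebra a \<Longrightarrow> g \<in> bump_algebra a \<Longrightarrow> (\<lambda>v. f v + g v) \<in> bump_algebra a"
| mult: "f \<in> bump_algebra a \<Longrightarrow> g \<in> bump_algebra a \<Longrightarrow> (\<lambda>v. f v * g v) \<in> bump_algebra a"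

lemma bump_algebra_derivative:
  fixes g :: "'a::euclidean_space \<Rightarrow> real"
  assumes "g \<in> bump_algebra a"
  shows "\<exists>g'. (\<forall>x. (g has_derivative g' x) (at x)) \<and> (\<forall>b. (\<lambda>x. g' x b) \<in> bump_algebra a)"
  using assms
proof induction
  case (const c)
  show ?case
    by (rule exI[of _ "\<lambda>_ _. 0"]) (auto intro: bump_algebra.const)
next
  case (coord b)
  show ?case
    by (rule exI[of _ "\<lambda>_ h. h \<bullet> b"]) (auto intro!: bump_algebra.const derivative_eq_intros)
next
  case (flat_exp n)
  let ?g' = "\<lambda>x h. ((-2 * a) * (x \<bullet> h)) * (flat_exp (n + 2) (1 - a * (x \<bullet> x)) + (- real n) * flat_exp (n + 1) (1 - a * (x \<bullet> x)))"
  have "((\<lambda>v. flat_exp n (1 - a * (v \<bullet> v))) has_derivative ?g' x) (at x)" for x :: 'a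
    by (auto intro!: derivative_eq_intros simp: inner_commute algebra_simps)
  moreover have "(\<lambda>x. ?g' x b) \<in> bump_algebra a" for b :: 'a
    by (intro bump_algebra.intros)
  ultimately show ?case
    by (intro exI[of _ ?g']) blast
next
  case (add f g)
  then obtain f' g' where
    "\<And>x. (f has_derivative f' x) (at x)" "\<And>b. (\<lambda>x. f' x b) \<in> bump_algebra a"
    "\<And>x. (g has_derivative g' x) (at x)" "\<And>b. (\<lambda>x. g' x b) \<in> bump_algebra a"
    by blast
  then show ?case
    by (intro exI[of _ "\<lambda>x h. f' x h + g' x h"]) (auto intro!: derivative_intros bump_algebra.add)
next
  case (mult f g)
  then obtain f' g' where
    "\<And>x. (f has_derivative f' x) (at x)" "\<And>b. (\<lambda>x. f' x b) \<in> bump_algebra a"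
    "\<And>x. (g has_derivative g' x) (at x)" "\<And>b. (\<lambda>x. g' x b) \<in> bump_algebra a"
    by blast
  with mult.hyps show ?case
    by (intro exI[of _ "\<lambda>x h. f x * g' x h + f' x h * g x"])
      (auto intro!: derivative_intros bump_algebra.add bump_algebra.mult)
qed

lemma test_function_bump:
  assumes "0 < a"
  shows "test_function (bump a :: 'a::euclidean_space \<Rightarrow> real)"
proof -
  have "C_k k (bump a :: 'a \<Rightarrow> real)" for k
  proof (rule C_k_of_derivative_closed[of "bump_algebra a"])
    show "bump a \<in> bump_algebra a"
      using bump_algebra.flat_exp[of 0 a] by (simp add: bump_def[abs_def])
  qed (use bump_algebra_derivative in blast)
  moreover have "{v :: 'a. bump a v \<noteq> 0} \<subseteq> cball 0 (sqrt (1 / a))"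
  proof
    fix v :: 'a assume "v \<in> {v. bump a v \<noteq> 0}"
    then have "a * (v \<bullet> v) < 1" by (auto simp: bump_def flat_exp_def split: if_splits)
    then have "(norm v)\<^sup>2 \<le> 1 / a" using assms by (simp add: power2_norm_eq_inner field_simps)
    then show "v \<in> cball 0 (sqrt (1 / a))" by (simp add: real_le_rsqrt)
  qed
  then have "bounded {v :: 'a. bump a v \<noteq> 0}"
    using bounded_cball bounded_subset by blast
  ultimately show ?thesis by (simp add: test_function_def)
qed

section \<open>The kernel of the collision operator\<close>

lemma gradient_eqI:
  assumes "(\<phi> has_derivative (\<lambda>h. h \<bullet> G)) (at x)"
  shows "gradient \<phi> x = G"
  unfolding gradient_def frechet_derivative_at[OF assms, symmetric]
  by (simp add: inner_commute[of _ G] euclidean_representation)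

lemma divergence_eqI:
  assumes "(F has_derivative F') (at x)"
  shows "divergence F x = (\<Sum>b\<in>Basis. F' b \<bullet> b)"
  unfolding divergence_def frechet_derivative_at[OF assms, symmetric] ..

lemma divergence_uminus:
  assumes "F differentiable (at x)"
  shows "divergence (\<lambda>x. - F x) x = - divergence F x"
proof -
  obtain F' where F': "(F has_derivative F') (at x)" using assms by (auto simp: differentiable_def)
  show ?thesis
    by (simp add: divergence_eqI[OF F'] divergence_eqI[OF has_derivative_minus[OF F']] sum_negf)
qed

lemma KS_flux_has_derivative:
  assumes "(gradient \<phi> has_derivative G') (at v)" and "v \<noteq> w"
  shows "((\<lambda>v'. KS_flux \<phi> v' w) has_derivative
     (\<lambda>h. G' h /\<^sub>R norm (v - w) - (((v - w) \<bullet> h) / norm (v - w) ^ 3) *\<^sub>R (gradient \<phi> v - gradient \<phi> w))) (at v)"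
proof -
  have "((\<lambda>v'. v' - w) has_derivative (\<lambda>h. h)) (at v)"
    by (auto intro!: derivative_eq_intros)
  then have norm': "((\<lambda>v'. norm (v' - w)) has_derivative (\<lambda>h. sgn (v - w) \<bullet> h)) (at v)"
    using assms(2) has_derivative_compose[OF _ has_derivative_norm, of "\<lambda>v'. v' - w" "\<lambda>h. h" v UNIV]
    by (simp add: inner_commute)
  have "((\<lambda>v'. inverse (norm (v' - w))) has_derivative (\<lambda>h. - (((v - w) \<bullet> h) / norm (v - w) ^ 3))) (at v)"
    using assms(2)
    by (auto intro!: derivative_eq_intros norm' simp: sgn_div_norm divide_inverse power3_eq_cube mult_ac)
  from has_derivative_scaleR[OF this has_derivative_diff[OF assms(1) has_derivative_const[of "gradient \<phi> w"]]]
  show ?thesis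
    unfolding KS_flux_def by (simp add: algebra_simps)
qed

lemma divergence_KS_flux:
  assumes "(gradient \<phi> has_derivative G') (at v)" and "v \<noteq> w"
  shows "divergence (\<lambda>v'. KS_flux \<phi> v' w) v
     = divergence (gradient \<phi>) v / norm (v - w)
       - (gradient \<phi> v - gradient \<phi> w) \<bullet> (v - w) / norm (v - w) ^ 3"
proof -
  let ?G = "gradient \<phi> v - gradient \<phi> w"
  have "divergence (\<lambda>v'. KS_flux \<phi> v' w) v
    = (\<Sum>b\<in>Basis. (G' b \<bullet> b) / norm (v - w) - ((?G \<bullet> b) * ((v - w) \<bullet> b)) / norm (v - w) ^ 3)"
    unfolding divergence_eqI[OF KS_flux_has_derivative[OF assms]]
    by (intro sum.cong) (auto simp: inner_diff_left divide_inverse algebra_simps)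
  also have "\<dots> = (\<Sum>b\<in>Basis. G' b \<bullet> b) / norm (v - w) - (\<Sum>b\<in>Basis. (?G \<bullet> b) * ((v - w) \<bullet> b)) / norm (v - w) ^ 3"
    by (simp only: sum_subtractf sum_divide_distrib)
  finally show ?thesis
    unfolding divergence_eqI[OF assms(1)] euclidean_inner[of ?G "v - w"] .
qed

text \<open>Off the diagonal, the product rule splits the kernel into the Laplacian of \<open>\<phi>\<close> at the two
  points and a term from differentiating \<open>1 / norm (v - w)\<close>. The latter occurs twice since
  \<open>1 / norm (v - w)\<close> has opposite gradients in \<open>v\<close> and \<open>w\<close>.\<close>

lemma KS_kernel_eq:
  assumes v: "gradient \<phi> differentiable (at v)" and w: "gradient \<phi> differentiable (at w)" and "v \<noteq> w"
  shows "KS_kernel \<phi> v w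
     = (divergence (gradient \<phi>) v + divergence (gradient \<phi>) w) / norm (v - w)
       - 2 * ((gradient \<phi> v - gradient \<phi> w) \<bullet> (v - w)) / norm (v - w) ^ 3"
proof -
  obtain V W where V: "(gradient \<phi> has_derivative V) (at v)" and W: "(gradient \<phi> has_derivative W) (at w)"
    using v w by (auto simp: differentiable_def)
  have "(\<lambda>w'. KS_flux \<phi> v w') = (\<lambda>w'. - KS_flux \<phi> w' v)"
    by (auto simp: KS_flux_def norm_minus_commute fun_eq_iff algebra_simps)
  moreover have "(\<lambda>w'. KS_flux \<phi> w' v) differentiable (at w)"
    using KS_flux_has_derivative[OF W, of v] \<open>v \<noteq> w\<close> by (auto simp: differentiable_def)
  ultimately have "divergence (\<lambda>w'. KS_flux \<phi> v w') w = - divergence (\<lambda>w'. KS_flux \<phi> w' v) w"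
    by (simp add: divergence_uminus)
  also have "divergence (\<lambda>w'. KS_flux \<phi> w' v) w = divergence (gradient \<phi>) w / norm (v - w)
       - (gradient \<phi> v - gradient \<phi> w) \<bullet> (v - w) / norm (v - w) ^ 3"
    using divergence_KS_flux[OF W, of v] \<open>v \<noteq> w\<close>
    by (simp add: norm_minus_commute algebra_simps)
  finally show ?thesis
    unfolding KS_kernel_def divergence_KS_flux[OF V \<open>v \<noteq> w\<close>]
    by (simp add: add_divide_distrib)
qed

text \<open>A bounded Hessian bounds the Laplacian, and it makes the gradient Lipschitz, which cancels two
  of the three powers of \<open>norm (v - w)\<close> in the last term of the kernel. Hence the kernel is no
  more singular than the Coulomb potential.\<close>

lemma abs_KS_kernel_le:
  fixes \<phi> :: "'a::euclidean_space \<Rightarrow> real" and L :: real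
  assumes G': "\<And>x. (gradient \<phi> has_derivative G' x) (at x)"
    and L: "\<And>x h. norm (G' x h) \<le> L * norm h"
    and "v \<noteq> w"
  shows "\<bar>KS_kernel \<phi> v w\<bar> \<le> (2 * DIM('a) + 2) * L / norm (v - w)"
proof -
  have div: "\<bar>divergence (gradient \<phi>) x\<bar> \<le> DIM('a) * L" for x
  proof -
    have "\<bar>divergence (gradient \<phi>) x\<bar> \<le> (\<Sum>b\<in>Basis. \<bar>G' x b \<bullet> b\<bar>)"
      unfolding divergence_eqI[OF G'] by (rule sum_abs)
    also have "\<dots> \<le> (\<Sum>b\<in>(Basis::'a set). L)"
      by (intro sum_mono order.trans[OF Cauchy_Schwarz_ineq2]) (use L[of x] in \<open>metis mult.right_neutral norm_Basis\<close>)
    finally show ?thesis by (simp only: sum_constant)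
  qed
  have lip: "norm (gradient \<phi> v - gradient \<phi> w) \<le> L * norm (v - w)"
    using differentiable_bound[of UNIV "gradient \<phi>" G' L v w] G' onorm_le[OF L] by auto
  let ?z = "v - w"
  have z: "0 < norm ?z" using \<open>v \<noteq> w\<close> by simp
  have "\<bar>(gradient \<phi> v - gradient \<phi> w) \<bullet> ?z\<bar> \<le> L * norm ?z * norm ?z"
    by (rule order.trans[OF Cauchy_Schwarz_ineq2]) (intro mult_right_mono lip norm_ge_zero)
  then have "\<bar>(gradient \<phi> v - gradient \<phi> w) \<bullet> ?z / norm ?z ^ 3\<bar> \<le> L / norm ?z"
    using z by (simp add: abs_divide field_simps power3_eq_cube)
  moreover have "\<bar>(divergence (gradient \<phi>) v + divergence (gradient \<phi>) w) / norm ?z\<bar> \<le> 2 * DIM('a) * L / norm ?z"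
    using z div[of v] div[of w] by (simp add: abs_divide divide_right_mono)
  moreover have "KS_kernel \<phi> v w = (divergence (gradient \<phi>) v + divergence (gradient \<phi>) w) / norm ?z
      - 2 * ((gradient \<phi> v - gradient \<phi> w) \<bullet> ?z / norm ?z ^ 3)"
    using G' \<open>v \<noteq> w\<close> by (subst KS_kernel_eq) (auto simp: differentiable_def)
  ultimately have "\<bar>KS_kernel \<phi> v w\<bar> \<le> 2 * DIM('a) * L / norm ?z + 2 * (L / norm ?z)"
    by linarith
  then show ?thesis by (simp add: add_divide_distrib algebra_simps)
qed

section \<open>The kernel for the radial test functions\<close>

lemma gradient_bump:
  "gradient (bump a) = (\<lambda>v::'a::euclidean_space. (- 2 * a * flat_exp 2 (1 - a * (v \<bullet> v))) *\<^sub>R v)"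
proof
  fix v :: 'a
  have "(bump a has_derivative (\<lambda>h. h \<bullet> ((- 2 * a * flat_exp 2 (1 - a * (v \<bullet> v))) *\<^sub>R v))) (at v)"
    unfolding bump_def[abs_def]
    by (auto intro!: derivative_eq_intros simp: inner_commute algebra_simps eval_nat_numeral)
  then show "gradient (bump a) v = (- 2 * a * flat_exp 2 (1 - a * (v \<bullet> v))) *\<^sub>R v"
    by (rule gradient_eqI)
qed

lemma gradient_bump_has_derivative:
  fixes v :: "'a::euclidean_space" and a :: real
  defines "s \<equiv> 1 - a * (v \<bullet> v)"
  shows "(gradient (bump a) has_derivative
    (\<lambda>h. a *\<^sub>R ((4 * a * (flat_exp 4 s - 2 * flat_exp 3 s) * (v \<bullet> h)) *\<^sub>R v - (2 * flat_exp 2 s) *\<^sub>R h))) (at v)"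
  unfolding gradient_bump s_def
  by (auto intro!: derivative_eq_intros simp: inner_commute algebra_simps eval_nat_numeral)

text \<open>The Laplacian of \<open>bump a\<close> divided by \<open>a\<close>.\<close>

definition rescaled_laplacian :: "real \<Rightarrow> 'a::euclidean_space \<Rightarrow> real" where
  "rescaled_laplacian a v =
    4 * a * (flat_exp 4 (1 - a * (v \<bullet> v)) - 2 * flat_exp 3 (1 - a * (v \<bullet> v))) * (v \<bullet> v)
    - 2 * DIM('a) * flat_exp 2 (1 - a * (v \<bullet> v))"

lemma divergence_gradient_bump:
  fixes v :: "'a::euclidean_space" and a :: real
  shows "divergence (gradient (bump a)) v = a * rescaled_laplacian a v"
proof -
  define s where "s = 1 - a * (v \<bullet> v)"
  have "divergence (gradient (bump a)) v = (\<Sum>b\<in>Basis.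
      a * (4 * a * (flat_exp 4 s - 2 * flat_exp 3 s)) * ((v \<bullet> b) * (v \<bullet> b)) - a * (2 * flat_exp 2 s))"
    unfolding divergence_eqI[OF gradient_bump_has_derivative] s_def[symmetric]
    by (intro sum.cong) (auto simp: inner_diff_left algebra_simps)
  also have "\<dots> = a * (4 * a * (flat_exp 4 s - 2 * flat_exp 3 s)) * (\<Sum>b\<in>Basis. (v \<bullet> b) * (v \<bullet> b))
      - DIM('a) * (a * (2 * flat_exp 2 s))"
    by (simp add: sum_subtractf sum_distrib_left)
  finally show ?thesis
    unfolding euclidean_inner[of v v, symmetric] rescaled_laplacian_def s_def[symmetric]
    by (simp add: algebra_simps)
qed

text \<open>The bound does not depend on \<open>a\<close>: it is the majorant for dominated convergence. The constant
  comes from \<open>3888 = 4 * (6! + 2 * 5!) + 2 * 4!\<close>, where the factorials bound \<open>flat_exp 4\<close>,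
  \<open>flat_exp 3\<close> and \<open>flat_exp 2\<close>.\<close>

lemma abs_KS_kernel_bump_le:
  fixes v w :: "'a::euclidean_space"
  assumes a: "0 < a" and "v \<noteq> w"
  shows "\<bar>KS_kernel (bump a) v w / a\<bar> \<le> (2 * DIM('a) + 2) * 3888 / norm (v - w)"
proof -
  have "norm (a *\<^sub>R ((4 * a * (flat_exp 4 (1 - a * (x \<bullet> x)) - 2 * flat_exp 3 (1 - a * (x \<bullet> x))) * (x \<bullet> h)) *\<^sub>R x
      - (2 * flat_exp 2 (1 - a * (x \<bullet> x))) *\<^sub>R h)) \<le> (a * 3888) * norm h" for x h :: 'a
  proof -
    define y where "y = a * (x \<bullet> x)"
    have y: "0 \<le> y" using a by (simp add: y_def)
    have "y * \<bar>flat_exp 4 (1 - y) - 2 * flat_exp 3 (1 - y)\<bar>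
        \<le> y * (\<bar>flat_exp 4 (1 - y)\<bar> + 2 * \<bar>flat_exp 3 (1 - y)\<bar>)"
      using y by (intro mult_left_mono) auto
    also have "\<dots> \<le> 960"
      using abs_flat_exp_one_minus_le(2)[OF y, of 4] abs_flat_exp_one_minus_le(2)[OF y, of 3]
      by (simp add: fact_numeral algebra_simps)
    finally have 1: "y * \<bar>flat_exp 4 (1 - y) - 2 * flat_exp 3 (1 - y)\<bar> \<le> 960" .
    have 2: "\<bar>flat_exp 2 (1 - y)\<bar> \<le> 24"
      using abs_flat_exp_one_minus_le(1)[OF y, of 2] by (simp add: fact_numeral)
    define X where "X = flat_exp 4 (1 - y) - 2 * flat_exp 3 (1 - y)"
    define Y where "Y = flat_exp 2 (1 - y)"
    note 1 = 1[folded X_def] and 2 = 2[folded Y_def]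
    have "norm ((4 * a * X * (x \<bullet> h)) *\<^sub>R x - (2 * Y) *\<^sub>R h)
      \<le> 4 * (a * \<bar>x \<bullet> h\<bar> * norm x) * \<bar>X\<bar> + 2 * \<bar>Y\<bar> * norm h"
      using a by (intro order.trans[OF norm_triangle_ineq4]) (simp add: abs_mult mult_ac)
    also have "\<dots> \<le> 4 * (y * norm h) * \<bar>X\<bar> + 2 * 24 * norm h"
    proof (intro add_mono mult_right_mono mult_left_mono 2)
      have "\<bar>x \<bullet> h\<bar> * norm x \<le> (norm x * norm h) * norm x"
        by (intro mult_right_mono Cauchy_Schwarz_ineq2) auto
      then have "a * (\<bar>x \<bullet> h\<bar> * norm x) \<le> a * ((norm x * norm h) * norm x)"
        using a by (intro mult_left_mono) auto
      then show "a * \<bar>x \<bullet> h\<bar> * norm x \<le> y * norm h"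
        by (simp add: y_def dot_square_norm power2_eq_square mult_ac)
    qed auto
    also have "\<dots> = (4 * (y * \<bar>X\<bar>) + 48) * norm h"
      by (simp add: algebra_simps)
    also have "\<dots> \<le> 3888 * norm h"
      using 1 by (intro mult_right_mono) auto
    finally show ?thesis
      unfolding norm_scaleR X_def Y_def y_def using a by simp
  qed
  from abs_KS_kernel_le[OF gradient_bump_has_derivative this \<open>v \<noteq> w\<close>]
  show ?thesis
    using a \<open>v \<noteq> w\<close> by (simp add: abs_divide field_simps)
qed

text \<open>The kernel of \<open>bump a\<close> divided by \<open>a\<close>, as an explicit Borel function with an evident limit
  as \<open>a\<close> tends to zero.\<close>

definition bump_kernel :: "real \<Rightarrow> 'a::euclidean_space \<Rightarrow> 'a \<Rightarrow> real" where
  "bump_kernel a v w =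
    (rescaled_laplacian a v + rescaled_laplacian a w) / norm (v - w)
    + 4 * ((flat_exp 2 (1 - a * (v \<bullet> v)) *\<^sub>R v - flat_exp 2 (1 - a * (w \<bullet> w)) *\<^sub>R w) \<bullet> (v - w)) / norm (v - w) ^ 3"

lemma KS_kernel_bump:
  fixes v w :: "'a::euclidean_space"
  assumes "a \<noteq> 0" "v \<noteq> w"
  shows "KS_kernel (bump a) v w / a = bump_kernel a v w"
proof -
  have diff: "gradient (bump a) differentiable (at x)" for x :: 'a
    using gradient_bump_has_derivative differentiable_def by blast
  have G: "(gradient (bump a) v - gradient (bump a) w) \<bullet> (v - w)
      = a * (- 2 * ((flat_exp 2 (1 - a * (v \<bullet> v)) *\<^sub>R v - flat_exp 2 (1 - a * (w \<bullet> w)) *\<^sub>R w) \<bullet> (v - w)))"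
    unfolding gradient_bump by (simp add: inner_diff_left algebra_simps)
  show ?thesis
    unfolding KS_kernel_eq[OF diff diff assms(2)] G divergence_gradient_bump bump_kernel_def
    using assms(1) by (simp add: diff_divide_distrib add_divide_distrib distrib_left[symmetric] mult.assoc)
qed

text \<open>The limit is \<open>- exp (- 1)\<close> times the kernel of \<open>v \<bullet> v\<close>: the Laplacians contribute
  \<open>4 * DIM('a)\<close> and the gradients take away \<open>4\<close>. In dimension two or higher the limit has a
  strict sign, and this is what forces a nonnegative solution to vanish.\<close>

lemma bump_kernel_tendsto:
  fixes v w :: "'a::euclidean_space"
  assumes "v \<noteq> w" and A: "A \<longlonglongrightarrow> 0"
  shows "(\<lambda>n. bump_kernel (A n) v w) \<longlonglongrightarrow> - 4 * (real DIM('a) - 1) * exp (- 1) / norm (v - w)"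
proof -
  have flat: "(\<lambda>n. flat_exp k (1 - A n * (x \<bullet> x))) \<longlonglongrightarrow> exp (- 1)" for k and x :: 'a
  proof -
    have "(\<lambda>n. 1 - A n * (x \<bullet> x)) \<longlonglongrightarrow> 1 - 0 * (x \<bullet> x)"
      by (intro tendsto_intros A)
    then have "(\<lambda>n. flat_exp k (1 - A n * (x \<bullet> x))) \<longlonglongrightarrow> flat_exp k 1"
      by (intro isCont_tendsto_compose[OF isCont_flat_exp]) simp
    then show ?thesis by (simp add: flat_exp_def)
  qed
  have "(\<lambda>n. bump_kernel (A n) v w) \<longlonglongrightarrow>
    ((4 * 0 * (exp (- 1) - 2 * exp (- 1)) * (v \<bullet> v) - 2 * DIM('a) * exp (- 1))
     + (4 * 0 * (exp (- 1) - 2 * exp (- 1)) * (w \<bullet> w) - 2 * DIM('a) * exp (- 1))) / norm (v - w)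
    + 4 * ((exp (- 1) *\<^sub>R v - exp (- 1) *\<^sub>R w) \<bullet> (v - w)) / norm (v - w) ^ 3"
    unfolding bump_kernel_def rescaled_laplacian_def
    by (intro tendsto_intros A flat) (use assms in auto)
  also have "(exp (- 1) *\<^sub>R v - exp (- 1) *\<^sub>R w) \<bullet> (v - w) = exp (- 1 :: real) * (norm (v - w))\<^sup>2"
    unfolding scaleR_diff_right[symmetric] by (simp add: dot_square_norm)
  also have "((4 * 0 * (exp (- 1) - 2 * exp (- 1)) * (v \<bullet> v) - 2 * DIM('a) * exp (- 1))
     + (4 * 0 * (exp (- 1) - 2 * exp (- 1)) * (w \<bullet> w) - 2 * DIM('a) * exp (- 1))) / norm (v - w)
    + 4 * (exp (- 1) * (norm (v - w))\<^sup>2) / norm (v - w) ^ 3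
    = - 4 * (real DIM('a) - 1) * exp (- 1) / norm (v - w)"
    using assms(1) by (simp add: power2_eq_square power3_eq_cube field_simps)
  finally show ?thesis .
qed

section \<open>Stationary solutions vanish\<close>

text \<open>A single \<open>v\<close> with \<open>g v \<noteq> 0\<close> whose section of the product is null already forces \<open>g\<close> to
  vanish almost everywhere; without such a \<open>v\<close>, almost every \<open>v\<close> is a zero of \<open>g\<close>.\<close>

lemma AE_zero_if_AE_product_zero:
  fixes g :: "'a::euclidean_space \<Rightarrow> real"
  assumes "AE z in (lborel :: ('a \<times> 'a) measure). g (fst z) * g (snd z) = 0"
  shows "AE v in lborel. g v = 0"
proof -
  have "AE v in lborel. AE w in lborel. g v * g w = 0"
    using lborel_pair.AE_pair[OF assms[folded lborel_prod]] by (simp only: fst_conv snd_conv)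
  show ?thesis
  proof (cases "\<exists>v. g v \<noteq> 0 \<and> (AE w in lborel. g v * g w = 0)")
    case True
    then show ?thesis by auto
  next
    case False
    with \<open>AE v in lborel. AE w in lborel. g v * g w = 0\<close> show ?thesis by auto
  qed
qed

theorem theorem1p4:
  fixes f :: "real^3 \<Rightarrow> real"
  assumes "in_Lp (6/5) f"
    and "AE v in lebesgue. 0 \<le> f v"
    and "\<And>\<phi> :: real^3 \<Rightarrow> real. test_function \<phi> \<Longrightarrow> KS_pairing f \<phi> = 0"
  shows "AE v in lebesgue. f v = 0"
proof -
  have f_meas: "f \<in> borel_measurable lebesgue" and f_int: "integrable lebesgue (\<lambda>x. \<bar>f x\<bar> powr (6/5))"
    using assms(1) by (auto simp: in_Lp_def)
  \<comment> \<open>A nonnegative Borel representative makes Tonelli's theorem for Borel measures available.\<close>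
  obtain h where h: "h \<in> borel_measurable lborel" "AE x in lborel. f x = h x"
    using completion_ex_borel_measurable_real[OF f_meas] by blast
  define g where "g x = max 0 (h x)" for x
  have g_meas [measurable]: "g \<in> borel_measurable borel"
    using h(1) unfolding g_def[abs_def] by measurable
  have g_nonneg: "0 \<le> g x" for x by (simp add: g_def)
  have fg: "AE x in lborel. f x = g x"
    using h(2) assms(2)[unfolded AE_completion_iff] by eventually_elim (simp add: g_def)
  have g_int: "integrable lborel (\<lambda>x. g x powr (6/5))"
  proof -
    have "integrable lebesgue (\<lambda>x. g x powr (6/5))"
      by (rule integrable_cong_AE_imp[OF f_int])
        (use AE_completion[OF fg] g_nonneg in \<open>auto intro!: measurable_completion elim!: eventually_mono\<close>)
    then show ?thesis by (simp add: integrable_completion)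
  qed
  obtain N where N: "N \<in> null_sets lborel" "{x. f x \<noteq> g x} \<subseteq> N"
    using AE_E[OF fg] by (auto simp: null_sets_def)
  then have [measurable]: "N \<in> sets borel" by auto
  have "AE z in lborel \<Otimes>\<^sub>M lborel. fst z \<notin> N \<and> snd z \<notin> N \<and> fst z \<noteq> (snd z :: real^3)"
  proof (rule lborel_pair.AE_pair_measure)
    show "AE v in lborel. AE w in lborel. fst (v, w) \<notin> N \<and> snd (v, w) \<notin> N \<and> fst (v, w) \<noteq> (snd (v, w) :: real^3)"
      using AE_not_in[OF N(1)]
    proof eventually_elim
      case (elim v)
      show ?case
        using AE_not_in[OF N(1)] AE_lborel_singleton[of v] by eventually_elim (use elim in auto)
    qed
  qed measurable
  then have good: "AE z in lborel. f (fst z) = g (fst z) \<and> f (snd z) = g (snd z) \<and> fst z \<noteq> snd z"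
    unfolding lborel_prod by eventually_elim (use N(2) in auto)
  \<comment> \<open>Up to constant factors both the majorant and the limit of the integrands.\<close>
  define W :: "(real^3) \<times> (real^3) \<Rightarrow> real" where "W z = g (fst z) * g (snd z) / norm (fst z - snd z)" for z
  have W_int: "integrable lborel W"
    unfolding W_def by (rule Coulomb_energy_integrable) (simp_all add: g_nonneg g_int)
  define a :: "nat \<Rightarrow> real" where "a n = 1 / (real n + 1)" for n
  have a_pos: "0 < a n" for n by (simp add: a_def)
  have a_lim: "a \<longlonglongrightarrow> 0"
    unfolding a_def[abs_def] using LIMSEQ_inverse_real_of_nat by (simp add: inverse_eq_divide add.commute)
  define s :: "nat \<Rightarrow> (real^3) \<times> (real^3) \<Rightarrow> real"
    where "s n z = g (fst z) * g (snd z) * bump_kernel (a n) (fst z) (snd z)" for n z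
  have s_meas [measurable]: "s n \<in> borel_measurable lborel" for n
    unfolding s_def[abs_def] bump_kernel_def rescaled_laplacian_def lborel_prod[symmetric] by measurable
  have s_zero: "(\<integral>z. s n z \<partial>lborel) = 0" for n
  proof -
    have ae: "AE z in lebesgue. a n * s n z = f (fst z) * f (snd z) * KS_kernel (bump (a n)) (fst z) (snd z)"
      using AE_completion[OF good]
    proof eventually_elim
      case (elim z)
      then have "KS_kernel (bump (a n)) (fst z) (snd z) = a n * bump_kernel (a n) (fst z) (snd z)"
        using KS_kernel_bump[of "a n" "fst z" "snd z"] a_pos[of n] by (simp add: field_simps)
      with elim show ?case by (simp add: s_def)
    qed
    have meas: "(\<lambda>z. a n * s n z) \<in> borel_measurable lebesgue"
      by (intro measurable_completion) measurable
    have "(\<integral>z. f (fst z) * f (snd z) * KS_kernel (bump (a n)) (fst z) (snd z) \<partial>lebesgue) = 0"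
      using assms(3)[OF test_function_bump[OF a_pos[of n]]] by (simp add: KS_pairing_def)
    also have "(\<integral>z. f (fst z) * f (snd z) * KS_kernel (bump (a n)) (fst z) (snd z) \<partial>lebesgue)
        = (\<integral>z. a n * s n z \<partial>lebesgue)"
      using ae by (intro integral_cong_AE borel_measurable_AE[OF meas ae] meas) auto
    also have "\<dots> = a n * (\<integral>z. s n z \<partial>lborel)"
      by (simp add: integral_completion)
    finally show ?thesis using a_pos[of n] by simp
  qed
  have "(\<lambda>n. \<integral>z. s n z \<partial>lborel) \<longlonglongrightarrow> (\<integral>z. (- 8 * exp (- 1)) * W z \<partial>lborel)"
  proof (rule integral_dominated_convergence)
    show "integrable lborel (\<lambda>z. (8 * 3888) * W z)"
      using W_int by simp
    show "AE z in lborel. (\<lambda>n. s n z) \<longlonglongrightarrow> (- 8 * exp (- 1)) * W z"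
      using good
    proof eventually_elim
      case (elim z)
      then have "(\<lambda>n. s n z) \<longlonglongrightarrow> g (fst z) * g (snd z) * (- 4 * (real DIM(real^3) - 1) * exp (- 1) / norm (fst z - snd z))"
        unfolding s_def by (intro tendsto_mult_left bump_kernel_tendsto a_lim) auto
      then show ?case by (simp add: W_def algebra_simps)
    qed
    show "AE z in lborel. norm (s n z) \<le> (8 * 3888) * W z" for n
      using good
    proof eventually_elim
      case (elim z)
      then have "\<bar>bump_kernel (a n) (fst z) (snd z)\<bar> \<le> (8 * 3888) / norm (fst z - snd z)"
        using abs_KS_kernel_bump_le[OF a_pos[of n], of "fst z" "snd z"] KS_kernel_bump[of "a n" "fst z" "snd z"] a_pos[of n]
        by simp
      then have "g (fst z) * g (snd z) * \<bar>bump_kernel (a n) (fst z) (snd z)\<bar>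
          \<le> g (fst z) * g (snd z) * ((8 * 3888) / norm (fst z - snd z))"
        using g_nonneg by (intro mult_left_mono) auto
      then show ?case
        using g_nonneg by (simp add: s_def W_def abs_mult mult_ac)
    qed
  qed (use W_int in auto)
  then have "(\<lambda>n. 0 :: real) \<longlonglongrightarrow> (- 8 * exp (- 1)) * (\<integral>z. W z \<partial>lborel)"
    by (simp add: s_zero)
  then have "(\<integral>z. W z \<partial>lborel) = 0"
    by (simp add: LIMSEQ_const_iff)
  moreover have "(\<integral>z. W z \<partial>lborel) = 0 \<longleftrightarrow> (AE z in lborel. W z = 0)"
    by (rule integral_nonneg_eq_0_iff_AE[OF W_int]) (simp add: W_def g_nonneg)
  ultimately have "AE z in lborel. W z = 0"
    by blast
  with good have "AE z in lborel. g (fst z) * g (snd z) = 0"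
    by eventually_elim (auto simp: W_def)
  then have "AE v in lborel. g v = 0"
    by (rule AE_zero_if_AE_product_zero)
  with fg have "AE v in lborel. f v = 0"
    by eventually_elim simp
  then show ?thesis by (rule AE_completion)
qed

end
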